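(* Let $R$ be an integrally closed domain. Then: (a) $\tilde{I}=I$ for every finitely generated nonzero ideal $I$ of $R$ if and only if $R$ is a Prüfer domain; (b) $\tilde{I}=I$ for every nonzero ideal $I$ of $R$ if and only if $R$ is a strongly discrete Prüfer domain.
   Context: For an integral domain $R$ and a nonzero (integral) ideal $I$ of $R$, the Ratliff-Rush closure of $I$ is $\tilde{I}=\bigcup_{n\ge 1}(I^{n+1}:_R I^n)$, where $(I^{n+1}:_R I^n)=\{x\in R : xI^n\subseteq I^{n+1}\}$; it is an ideal of $R$. A Prüfer domain $R$ is strongly discrete if $P\neq P^2$ for each nonzero prime ideal $P$ of $R$. *)

theory Defs
  imports "HOL-Computational_Algebra.Computational_Algebra"
begin

text \<open>
  A domain is a type of class \<open>idom\<close>, with quotient field \<open>'a fract\<close> and embedding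
  \<open>to_fract\<close>. Properties of the domain itself are predicates on \<open>'a itself\<close>.
\<close>

subsection \<open>Ideals\<close>

text \<open>
  The ideals of a commutative ring are its submodules for the multiplication as scaling. The
  locale is deliberately not interpreted with this scaling: its simp rule \<open>scale_scale\<close> would
  become \<open>a * (b * c) = a * b * c\<close>, which loops with associativity.
\<close>

lemma module_ring: "module ((*) :: 'a::comm_ring_1 \<Rightarrow> 'a \<Rightarrow> 'a)"
  by unfold_locales (auto simp: algebra_simps)

definition is_ideal :: "'a::comm_ring_1 set \<Rightarrow> bool"
  where "is_ideal I \<longleftrightarrow> module.subspace (*) I"

definition ideal_gen :: "'a::comm_ring_1 set \<Rightarrow> 'a set"
  where "ideal_gen S = module.span (*) S"

lemma is_ideal_iff:
  "is_ideal I \<longleftrightarrow> 0 \<in> I \<and> (\<forall>x\<in>I. \<forall>y\<in>I. x + y \<in> I) \<and> (\<forall>r. \<forall>x\<in>I. r * x \<in> I)"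
  by (simp add: is_ideal_def module.subspace_def[OF module_ring])

lemma ideal_gen_eq_Inter: "ideal_gen S = \<Inter>{I. is_ideal I \<and> S \<subseteq> I}"
  by (simp add: ideal_gen_def is_ideal_def module.span_def[OF module_ring] hull_def)

definition fin_gen_ideal :: "'a::comm_ring_1 set \<Rightarrow> bool"
  where "fin_gen_ideal I \<longleftrightarrow> (\<exists>S. finite S \<and> I = ideal_gen S)"

definition prime_ideal :: "'a::comm_ring_1 set \<Rightarrow> bool"
  where "prime_ideal P \<longleftrightarrow>
    is_ideal P \<and> P \<noteq> UNIV \<and> (\<forall>a b. a * b \<in> P \<longrightarrow> a \<in> P \<or> b \<in> P)"

definition ideal_mult :: "'a::comm_ring_1 set \<Rightarrow> 'a set \<Rightarrow> 'a set"
  where "ideal_mult I J = ideal_gen {a * b | a b. a \<in> I \<and> b \<in> J}"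

primrec ideal_power :: "'a::comm_ring_1 set \<Rightarrow> nat \<Rightarrow> 'a set" where
  "ideal_power I 0 = UNIV"
| "ideal_power I (Suc n) = ideal_mult I (ideal_power I n)"

definition ideal_colon :: "'a::comm_ring_1 set \<Rightarrow> 'a set \<Rightarrow> 'a set"
  where "ideal_colon I J = {x. \<forall>y\<in>J. x * y \<in> I}"

definition ratliff_rush :: "'a::comm_ring_1 set \<Rightarrow> 'a set"
  where "ratliff_rush I = (\<Union>n\<in>{1..}. ideal_colon (ideal_power I (n + 1)) (ideal_power I n))"


subsection \<open>Integrally closed domains\<close>

definition integral_over_domain :: "'a::idom fract \<Rightarrow> bool"
  where "integral_over_domain x \<longleftrightarrow> (\<exists>p::'a poly. lead_coeff p = 1 \<and> poly (fract_poly p) x = 0)"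

definition integrally_closed_domain :: "'a::idom itself \<Rightarrow> bool"
  where "integrally_closed_domain _ \<longleftrightarrow>
    (\<forall>x::'a fract. integral_over_domain x \<longrightarrow> x \<in> range to_fract)"


subsection \<open>Invertible ideals and Pruefer domains\<close>

definition fract_scale :: "'a::idom \<Rightarrow> 'a fract \<Rightarrow> 'a fract"
  where "fract_scale r x = to_fract r * x"

lemma module_fract: "module (fract_scale :: 'a::idom \<Rightarrow> _)"
  by unfold_locales (auto simp: fract_scale_def algebra_simps)

text \<open>\<open>(R :\<^sub>K I)\<close>, where \<open>K\<close> is the quotient field of the domain \<open>R\<close>.\<close>

definition inverse_ideal :: "'a::idom set \<Rightarrow> 'a fract set"
  where "inverse_ideal I = {x. \<forall>a\<in>I. x * to_fract a \<in> range to_fract}"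

definition invertible_ideal :: "'a::idom set \<Rightarrow> bool"
  where "invertible_ideal I \<longleftrightarrow>
    module.span fract_scale {to_fract a * x | a x. a \<in> I \<and> x \<in> inverse_ideal I} = range to_fract"

definition prufer_domain :: "'a::idom itself \<Rightarrow> bool"
  where "prufer_domain _ \<longleftrightarrow>
    (\<forall>I::'a set. is_ideal I \<and> I \<noteq> {0} \<and> fin_gen_ideal I \<longrightarrow> invertible_ideal I)"

definition strongly_discrete_prufer_domain :: "'a::idom itself \<Rightarrow> bool"
  where "strongly_discrete_prufer_domain T \<longleftrightarrow> prufer_domain T \<and>
    (\<forall>P::'a set. prime_ideal P \<and> P \<noteq> {0} \<longrightarrow> P \<noteq> ideal_power P 2)"

end

theory Submission
  imports Defs
begin

text \<open>
  Throughout, \<open>R\<close> is a domain with quotient field \<open>K\<close>. The proof passes through an elementwise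
  form of the Pruefer property: for all \<open>a, b\<close> there is \<open>u\<close> with \<open>u a \<in> (b)\<close> and
  \<open>(1 - u) b \<in> (a)\<close> (lemma \<open>prufer_domain_iff_arithmetical\<close>). It says that divisibility is total
  locally, and it replaces localisation in most arguments.

  Part (a). An invertible ideal can be cancelled from an inclusion \<open>y I \<subseteq> I A\<close>, so it equals its
  Ratliff-Rush closure. Conversely, let \<open>a, b \<noteq> 0\<close> and \<open>J = (a\<^sup>4, a\<^sup>3 b, a b\<^sup>3, b\<^sup>4)\<close>. Then
  \<open>a\<^sup>2 b\<^sup>2 J \<subseteq> J\<^sup>2\<close>, so \<open>a\<^sup>2 b\<^sup>2 \<in> J\<close> if \<open>J\<close> is its own closure, and dividing by \<open>b\<^sup>4\<close> makes
  \<open>a / b\<close> a root of a quartic over \<open>R\<close> with coefficient \<open>1\<close> at \<open>X\<^sup>2\<close>. Over an integrally closed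
  domain, an element \<open>x\<close> of \<open>K\<close> that is a root of a polynomial with some coefficient \<open>1\<close> generates
  an invertible fractional ideal \<open>(1, x)\<close> (lemma \<open>root_unit_coeff\<close>), which yields \<open>u\<close>.

  Part (b). If \<open>P = P\<^sup>2\<close>, then \<open>1\<close> lies in the closure of \<open>P\<close>, so a nonzero prime \<open>P\<close> that is its
  own closure satisfies \<open>P \<noteq> P\<^sup>2\<close>. Conversely, in a Pruefer domain, suppose \<open>x I\<^sup>n \<subseteq> I\<^sup>n\<^sup>+\<^sup>1\<close>
  with \<open>n \<ge> 1\<close> and \<open>x \<notin> I\<close>. Let \<open>M\<close> be a prime ideal containing \<open>L = (I : x)\<close>. Locally at \<open>M\<close> we
  have \<open>I = x L\<close>, hence \<open>L\<^sup>n = L\<^sup>2\<^sup>n\<close>. A proper idempotent ideal of a valuation domain is prime, so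
  the contraction of \<open>L\<^sup>n\<close> is a nonzero prime ideal, and it turns out to be idempotent in \<open>R\<close>
  (lemma \<open>locally_idempotent_prime\<close>), which strong discreteness forbids.
\<close>

section \<open>Ideals, products and powers\<close>

lemma is_idealI:
  assumes "0 \<in> I" "\<And>x y. x \<in> I \<Longrightarrow> y \<in> I \<Longrightarrow> x + y \<in> I" "\<And>r x. x \<in> I \<Longrightarrow> r * x \<in> I"
  shows "is_ideal I"
  using assms by (auto simp: is_ideal_iff)

lemma is_ideal_0: "is_ideal I \<Longrightarrow> 0 \<in> I"
  and is_ideal_add: "is_ideal I \<Longrightarrow> x \<in> I \<Longrightarrow> y \<in> I \<Longrightarrow> x + y \<in> I"
  and is_ideal_mult: "is_ideal I \<Longrightarrow> x \<in> I \<Longrightarrow> r * x \<in> I"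
  and is_ideal_mult_right: "is_ideal I \<Longrightarrow> x \<in> I \<Longrightarrow> x * r \<in> I"
  by (auto simp: is_ideal_iff mult.commute)

lemma is_ideal_UNIV: "is_ideal UNIV"
  by (rule is_idealI) auto

lemma is_ideal_ideal_gen: "is_ideal (ideal_gen S)"
  unfolding is_ideal_def ideal_gen_def by (rule module.subspace_span[OF module_ring])

lemma ideal_gen_superset: "S \<subseteq> ideal_gen S"
  by (auto simp: ideal_gen_eq_Inter)

lemma ideal_gen_minimal: "is_ideal I \<Longrightarrow> S \<subseteq> I \<Longrightarrow> ideal_gen S \<subseteq> I"
  by (auto simp: ideal_gen_eq_Inter)

lemma is_ideal_ideal_mult: "is_ideal (ideal_mult I J)"
  by (simp add: ideal_mult_def is_ideal_ideal_gen)

lemma ideal_mult_mem: "a \<in> I \<Longrightarrow> b \<in> J \<Longrightarrow> a * b \<in> ideal_mult I J"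
  unfolding ideal_mult_def by (rule subsetD[OF ideal_gen_superset]) auto

lemma ideal_mult_subset:
  assumes "is_ideal K" "\<And>a b. a \<in> I \<Longrightarrow> b \<in> J \<Longrightarrow> a * b \<in> K"
  shows "ideal_mult I J \<subseteq> K"
  unfolding ideal_mult_def using assms by (intro ideal_gen_minimal) auto

lemma ideal_mult_UNIV: "is_ideal I \<Longrightarrow> ideal_mult I UNIV = I"
  using ideal_mult_subset[of I I UNIV] ideal_mult_mem[of _ I 1 UNIV]
  by (auto simp: is_ideal_mult_right)

lemma ideal_mult_assoc_subset:
  "ideal_mult I (ideal_mult J K) \<subseteq> ideal_mult (ideal_mult I J) K"
proof (rule ideal_mult_subset[OF is_ideal_ideal_mult])
  fix a z assume a: "a \<in> I" and z: "z \<in> ideal_mult J K"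
  have "ideal_mult J K \<subseteq> {z. a * z \<in> ideal_mult (ideal_mult I J) K}" (is "_ \<subseteq> ?T")
  proof (rule ideal_mult_subset)
    show "is_ideal ?T"
      using is_ideal_ideal_mult[of "ideal_mult I J" K]
      by (intro is_idealI)
        (auto simp: distrib_left is_ideal_0 is_ideal_add mult.left_commute[of a] is_ideal_mult)
    show "b * c \<in> ?T" if "b \<in> J" "c \<in> K" for b c
      using ideal_mult_mem[OF ideal_mult_mem[OF a that(1)] that(2)] by (simp add: mult.assoc)
  qed
  with z show "a * z \<in> ideal_mult (ideal_mult I J) K" by auto
qed

lemma ideal_mult_mono: "I \<subseteq> I' \<Longrightarrow> J \<subseteq> J' \<Longrightarrow> ideal_mult I J \<subseteq> ideal_mult I' J'"
  by (intro ideal_mult_subset is_ideal_ideal_mult) (auto intro: ideal_mult_mem)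

lemma is_ideal_ideal_power: "is_ideal (ideal_power I n)"
  by (cases n) (auto simp: is_ideal_UNIV is_ideal_ideal_mult)

lemma ideal_power_add_subset:
  "ideal_power I (m + n) \<subseteq> ideal_mult (ideal_power I m) (ideal_power I n)"
proof (induction m)
  case 0
  then show ?case using ideal_mult_mem[of 1 UNIV _ "ideal_power I n"] by auto
next
  case (Suc m)
  have "ideal_power I (Suc m + n) \<subseteq> ideal_mult I (ideal_mult (ideal_power I m) (ideal_power I n))"
    using Suc.IH by (auto intro: subsetD[OF ideal_mult_mono, rotated -1])
  also have "\<dots> \<subseteq> ideal_mult (ideal_power I (Suc m)) (ideal_power I n)"
    by (simp add: ideal_mult_assoc_subset)
  finally show ?case .
qed

lemma ideal_power_2: "is_ideal I \<Longrightarrow> ideal_power I 2 = ideal_mult I I"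
  by (simp add: numeral_2_eq_2 ideal_mult_UNIV)

lemma power_mem_ideal_power: "a \<in> I \<Longrightarrow> a ^ n \<in> ideal_power I n"
  by (induction n) (auto intro: ideal_mult_mem)

lemma ideal_power_subset:
  assumes I: "is_ideal I" and n: "n \<ge> 1"
  shows "ideal_power I n \<subseteq> I"
proof -
  obtain m where "n = Suc m" using n by (cases n) auto
  then show ?thesis using ideal_mult_subset[OF I is_ideal_mult_right[OF I]] by simp
qed

lemma ratliff_rushI:
  "n \<ge> 1 \<Longrightarrow> (\<And>y. y \<in> ideal_power I n \<Longrightarrow> x * y \<in> ideal_power I (Suc n)) \<Longrightarrow> x \<in> ratliff_rush I"
  by (force simp: ratliff_rush_def ideal_colon_def)

lemma ratliff_rushE:
  assumes "x \<in> ratliff_rush I"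
  obtains n where "n \<ge> 1" "\<And>y. y \<in> ideal_power I n \<Longrightarrow> x * y \<in> ideal_power I (Suc n)"
  using assms by (auto simp: ratliff_rush_def ideal_colon_def)

lemma ratliff_rush_superset: "is_ideal I \<Longrightarrow> I \<subseteq> ratliff_rush I"
  by (auto intro!: ratliff_rushI[of 1] intro: ideal_mult_mem)


section \<open>Arithmetical domains and invertible ideals\<close>

text \<open>
  The ideals \<open>((b) : (a))\<close> and \<open>((a) : (b))\<close> are comaximal, for all elements \<open>a\<close> and \<open>b\<close>.
  Equivalently, of any two elements one divides the other locally at each maximal ideal.
\<close>

definition arithmetical :: "'a::idom itself \<Rightarrow> bool"
  where "arithmetical _ \<longleftrightarrow> (\<forall>a b::'a. \<exists>u. b dvd u * a \<and> a dvd (1 - u) * b)"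

lemma arithmeticalE:
  assumes "arithmetical TYPE('a::idom)"
  obtains u where "(b::'a) dvd u * a" "a dvd (1 - u) * b"
  using assms unfolding arithmetical_def by blast

text \<open>
  For \<open>i \<noteq> 0\<close>, the divisibility says that \<open>s i / i\<close> lies in the inverse of the ideal \<open>(S)\<close>, so the
  sum exhibits \<open>1\<close> as an element of \<open>(S) (S)\<^sup>-\<^sup>1\<close>.
\<close>

lemma arithmetical_partition_of_unity:
  assumes ar: "arithmetical TYPE('a::idom)" and S: "finite S" "S \<noteq> {}"
  shows "\<exists>s. (\<Sum>i\<in>S. s i) = 1 \<and> (\<forall>i\<in>S. \<forall>j\<in>S. (i::'a) dvd s i * j)"
  using S
proof (induction S rule: finite_ne_induct)
  case (singleton a)
  then show ?case by (intro exI[of _ "\<lambda>_. 1"]) auto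
next
  case (insert c S)
  then obtain s where s: "(\<Sum>i\<in>S. s i) = 1" "\<And>i j. i \<in> S \<Longrightarrow> j \<in> S \<Longrightarrow> i dvd s i * j"
    by blast
  have "\<forall>i. \<exists>u. c dvd u * i \<and> i dvd (1 - u) * c"
    using ar by (auto simp: arithmetical_def)
  then obtain u where u: "\<And>i. c dvd u i * i" "\<And>i. i dvd (1 - u i) * c"
    by metis
  \<comment> \<open>Each \<open>s i\<close> is split as \<open>s i u i + s i (1 - u i)\<close>, and the first parts are collected at \<open>c\<close>.\<close>
  define t where "t = (\<lambda>i. if i = c then \<Sum>k\<in>S. s k * u k else s i * (1 - u i))"
  have "(\<Sum>i\<in>S. t i) = (\<Sum>i\<in>S. s i * (1 - u i))"
    using insert.hyps by (intro sum.cong) (auto simp: t_def)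
  then have "(\<Sum>i\<in>insert c S. t i) = (\<Sum>k\<in>S. s k * u k) + (\<Sum>i\<in>S. s i * (1 - u i))"
    using insert.hyps by (simp add: t_def)
  also have "\<dots> = (\<Sum>i\<in>S. s i)"
    unfolding sum.distrib[symmetric] by (intro sum.cong) (auto simp: algebra_simps)
  finally have sum: "(\<Sum>i\<in>insert c S. t i) = 1"
    using s by simp
  have "i dvd t i * j" if i: "i \<in> insert c S" and j: "j \<in> insert c S" for i j
  proof (cases "i = c")
    case True
    have "c dvd s k * u k * j" if "k \<in> S" for k
    proof (cases "j = c")
      case False
      then have "k dvd s k * j" using j that s by blast
      then have "u k * k dvd u k * (s k * j)" by (rule mult_dvd_mono[OF dvd_refl])
      with u(1)[of k] show ?thesis by (metis dvd_trans mult.assoc mult.commute)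
    qed simp
    then show ?thesis
      using True by (auto simp: t_def sum_distrib_right intro: dvd_sum)
  next
    case False
    then have "i \<in> S" using i by simp
    have "i dvd s i * (1 - u i) * j"
    proof (cases "j = c")
      case True
      show ?thesis using u(2)[of i] unfolding True by (metis dvd_mult mult.assoc)
    next
      case False
      then have "i dvd s i * j" using j \<open>i \<in> S\<close> s by blast
      then show ?thesis by (metis dvd_mult2 mult.assoc mult.commute)
    qed
    then show ?thesis using False by (simp add: t_def)
  qed
  with sum show ?case by blast
qed

lemma fract_subspace_iff:
  "module.subspace fract_scale T \<longleftrightarrow>
    0 \<in> T \<and> (\<forall>x\<in>T. \<forall>y\<in>T. x + y \<in> T) \<and> (\<forall>r. \<forall>x\<in>T. to_fract r * x \<in> T)"
  by (simp add: module.subspace_def[OF module_fract] fract_scale_def)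

lemma inverse_idealD: "x \<in> inverse_ideal I \<Longrightarrow> a \<in> I \<Longrightarrow> \<exists>r. to_fract a * x = to_fract r"
  by (auto simp: inverse_ideal_def mult.commute)

lemma subspace_range_to_fract: "module.subspace fract_scale (range to_fract)"
  unfolding fract_subspace_iff
  by (auto simp flip: to_fract_0 to_fract_add to_fract_mult simp del: to_fract_0 to_fract_add to_fract_mult)

lemma invertible_idealI:
  assumes "1 \<in> module.span fract_scale {to_fract a * x | a x. a \<in> I \<and> x \<in> inverse_ideal I}"
    (is "1 \<in> module.span fract_scale ?G")
  shows "invertible_ideal I"
proof -
  have "module.span fract_scale ?G \<subseteq> range to_fract"
    by (intro module.span_minimal[OF module_fract] subspace_range_to_fract)
      (auto dest!: inverse_idealD)
  moreover have "to_fract r \<in> module.span fract_scale ?G" for r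
    using module.span_scale[OF module_fract assms, of r] by (simp add: fract_scale_def)
  ultimately show ?thesis
    unfolding invertible_ideal_def by blast
qed

text \<open>
  To prove a property of \<open>1\<close> from the invertibility of \<open>I\<close>, it suffices that the property defines
  a submodule of \<open>K\<close> that contains all products generating \<open>I I\<^sup>-\<^sup>1\<close>.
\<close>

lemma invertible_ideal_one_mem:
  assumes "invertible_ideal I" "module.subspace fract_scale T"
    and "\<And>a x. a \<in> I \<Longrightarrow> x \<in> inverse_ideal I \<Longrightarrow> to_fract a * x \<in> T"
  shows "1 \<in> T"
proof -
  have "module.span fract_scale {to_fract a * x | a x. a \<in> I \<and> x \<in> inverse_ideal I} \<subseteq> T"
    using assms(3) by (intro module.span_minimal[OF module_fract _ assms(2)]) blast
  then have "range to_fract \<subseteq> T"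
    using assms(1) by (simp add: invertible_ideal_def)
  then have "to_fract 1 \<in> T" by blast
  then show ?thesis by simp
qed

lemma invertible_pair:
  assumes inv: "invertible_ideal (ideal_gen {a, b :: 'a::idom})"
  shows "\<exists>u. b dvd u * a \<and> a dvd (1 - u) * b"
proof -
  let ?I = "ideal_gen {a, b}"
  let ?T = "{to_fract a * f + to_fract b * g | f g. f \<in> inverse_ideal ?I \<and> g \<in> inverse_ideal ?I}"
  note sub = subspace_range_to_fract[unfolded fract_subspace_iff]
  have inv0: "0 \<in> inverse_ideal ?I"
    by (auto simp: inverse_ideal_def intro!: range_eqI[of _ _ 0])
  have invadd: "f + g \<in> inverse_ideal ?I" if "f \<in> inverse_ideal ?I" "g \<in> inverse_ideal ?I" for f g
    using that sub unfolding inverse_ideal_def mem_Collect_eq distrib_right by blast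
  have invmult: "to_fract r * f \<in> inverse_ideal ?I" if "f \<in> inverse_ideal ?I" for f r
    using that sub unfolding inverse_ideal_def mem_Collect_eq mult.assoc by blast
  have "1 \<in> ?T"
  proof (rule invertible_ideal_one_mem[OF inv])
    show "module.subspace fract_scale ?T"
      unfolding fract_subspace_iff
    proof (intro conjI ballI allI)
      show "0 \<in> ?T" using inv0 by force
    next
      fix x y assume "x \<in> ?T" "y \<in> ?T"
      then obtain f g f' g' where "x = to_fract a * f + to_fract b * g"
        "y = to_fract a * f' + to_fract b * g'" and
        m: "f \<in> inverse_ideal ?I" "g \<in> inverse_ideal ?I" "f' \<in> inverse_ideal ?I" "g' \<in> inverse_ideal ?I"
        by blast
      then have "x + y = to_fract a * (f + f') + to_fract b * (g + g')"
        by (simp add: algebra_simps)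
      then show "x + y \<in> ?T" using m invadd by blast
    next
      fix r x assume "x \<in> ?T"
      then obtain f g where "x = to_fract a * f + to_fract b * g" and
        m: "f \<in> inverse_ideal ?I" "g \<in> inverse_ideal ?I"
        by blast
      then have "to_fract r * x = to_fract a * (to_fract r * f) + to_fract b * (to_fract r * g)"
        by (simp add: algebra_simps)
      then show "to_fract r * x \<in> ?T" using m invmult by blast
    qed
  next
    fix c x assume c: "c \<in> ?I" and x: "x \<in> inverse_ideal ?I"
    let ?L = "{p * a + q * b | p q. True}"
    have "?I \<subseteq> ?L"
    proof (rule ideal_gen_minimal)
      show "is_ideal ?L"
      proof (rule is_idealI)
        show "0 \<in> ?L" by (auto intro!: exI[of _ 0])
        show "y + z \<in> ?L" if "y \<in> ?L" "z \<in> ?L" for y z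
        proof -
          from that obtain p q p' q' where "y = p * a + q * b" "z = p' * a + q' * b" by blast
          then have "y + z = (p + p') * a + (q + q') * b" by (simp add: algebra_simps)
          then show ?thesis by blast
        qed
        show "r * y \<in> ?L" if "y \<in> ?L" for r y
        proof -
          from that obtain p q where "y = p * a + q * b" by blast
          then have "r * y = (r * p) * a + (r * q) * b" by (simp add: algebra_simps)
          then show ?thesis by blast
        qed
      qed
      have "a = 1 * a + 0 * b" "b = 0 * a + 1 * b" by auto
      then show "{a, b} \<subseteq> ?L" by blast
    qed
    then obtain p q where "c = p * a + q * b" using c by blast
    then have "to_fract c * x = to_fract a * (to_fract p * x) + to_fract b * (to_fract q * x)"
      by (simp add: algebra_simps)
    then show "to_fract c * x \<in> ?T" using x invmult by blast
  qed
  then obtain f g where fg: "to_fract a * f + to_fract b * g = 1"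
    "f \<in> inverse_ideal ?I" "g \<in> inverse_ideal ?I" by force
  have ab: "a \<in> ?I" "b \<in> ?I" using ideal_gen_superset[of "{a, b}"] by auto
  obtain u where u: "to_fract b * g = to_fract u" using inverse_idealD[OF fg(3) ab(2)] by blast
  obtain v where v: "to_fract a * g = to_fract v" using inverse_idealD[OF fg(3) ab(1)] by blast
  obtain w where w: "to_fract b * f = to_fract w" using inverse_idealD[OF fg(2) ab(2)] by blast
  have "to_fract (u * a) = to_fract (b * v)"
    by (simp flip: u v)
  moreover have "to_fract ((1 - u) * b) = to_fract (a * w)"
  proof -
    have "1 - to_fract u = to_fract a * f" using fg(1) u by (simp add: algebra_simps)
    then show ?thesis by (simp flip: w)
  qed
  ultimately show ?thesis
    unfolding to_fract_eq_iff by (metis dvd_triv_left)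
qed

lemma arithmetical_imp_prufer:
  assumes "arithmetical TYPE('a::idom)"
  shows "prufer_domain TYPE('a)"
  unfolding prufer_domain_def
proof (intro allI impI, elim conjE)
  fix I :: "'a set" assume "I \<noteq> {0}" and "fin_gen_ideal I"
  then obtain S where S: "finite S" "I = ideal_gen S" by (auto simp: fin_gen_ideal_def)
  have ne: "\<exists>j\<in>S. j \<noteq> 0"
  proof (rule ccontr)
    assume "\<not> (\<exists>j\<in>S. j \<noteq> 0)"
    then have "I \<subseteq> {0}" unfolding S by (intro ideal_gen_minimal is_idealI) auto
    with \<open>I \<noteq> {0}\<close> show False using is_ideal_0[OF is_ideal_ideal_gen[of S]] S by auto
  qed
  then have "S \<noteq> {}" by auto
  then obtain s where s: "(\<Sum>i\<in>S. s i) = 1" "\<And>i j. i \<in> S \<Longrightarrow> j \<in> S \<Longrightarrow> i dvd s i * j"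
    using arithmetical_partition_of_unity[OF assms S(1)] by blast
  define f where "f i = to_fract (s i) / to_fract i" for i
  \<comment> \<open>If \<open>0 \<in> S\<close>, then \<open>s 0 = 0\<close>, because \<open>0\<close> divides \<open>s 0 * j\<close> for some \<open>j \<noteq> 0\<close>.\<close>
  have f: "to_fract i * f i = to_fract (s i)" if "i \<in> S" for i
    using s(2)[OF that] ne that by (cases "i = 0") (auto simp: f_def)
  let ?G = "{to_fract a * x | a x. a \<in> I \<and> x \<in> inverse_ideal I}"
  have "f i \<in> inverse_ideal I" if "i \<in> S" for i
    unfolding inverse_ideal_def mem_Collect_eq
  proof
    fix a assume "a \<in> I"
    have "I \<subseteq> {a. i dvd s i * a}"
      unfolding S(2) using s(2)[OF that]
      by (intro ideal_gen_minimal is_idealI) (auto simp: distrib_left mult.left_commute[of "s i"])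
    then obtain w where w: "s i * a = i * w" using \<open>a \<in> I\<close> by (auto elim: dvdE)
    show "f i * to_fract a \<in> range to_fract"
    proof (cases "i = 0")
      case True
      then show ?thesis by (auto simp: f_def intro!: range_eqI[of _ _ 0])
    next
      case False
      have "to_fract (s i) * to_fract a = to_fract i * to_fract w"
        using w by (simp flip: to_fract_mult)
      then have "f i * to_fract a = to_fract w" using False by (simp add: f_def)
      then show ?thesis by simp
    qed
  qed
  then have "to_fract i * f i \<in> module.span fract_scale ?G" if "i \<in> S" for i
    using that ideal_gen_superset[of S] S(2) by (intro module.span_base[OF module_fract]) blast
  then have "(\<Sum>i\<in>S. to_fract i * f i) \<in> module.span fract_scale ?G"
    by (rule module.span_sum[OF module_fract])
  also have "(\<Sum>i\<in>S. to_fract i * f i) = to_fract (\<Sum>i\<in>S. s i)"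
    by (simp add: f)
  finally show "invertible_ideal I"
    using s(1) by (intro invertible_idealI) simp
qed

lemma prufer_domain_iff_arithmetical:
  "prufer_domain TYPE('a::idom) \<longleftrightarrow> arithmetical TYPE('a)"
proof
  assume pr: "prufer_domain TYPE('a)"
  show "arithmetical TYPE('a)"
    unfolding arithmetical_def
  proof (intro allI)
    fix a b :: 'a
    show "\<exists>u. b dvd u * a \<and> a dvd (1 - u) * b"
    proof (cases "a = 0 \<and> b = 0")
      case True
      then show ?thesis by simp
    next
      case False
      then have "ideal_gen {a, b} \<noteq> {0}" using ideal_gen_superset[of "{a, b}"] by auto
      moreover have "fin_gen_ideal (ideal_gen {a, b})"
        unfolding fin_gen_ideal_def by (intro exI[of _ "{a, b}"]) auto
      ultimately show ?thesis
        using pr by (intro invertible_pair) (auto simp: prufer_domain_def is_ideal_ideal_gen)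
    qed
  qed
qed (rule arithmetical_imp_prufer)

lemma invertible_ideal_cancel:
  fixes I A :: "'a::idom set"
  assumes inv: "invertible_ideal I" and A: "is_ideal A"
    and y: "\<And>a. a \<in> I \<Longrightarrow> y * a \<in> ideal_mult I A"
  shows "y \<in> A"
proof -
  let ?T = "{k. to_fract y * k \<in> to_fract ` A}"
  have sub: "module.subspace fract_scale (to_fract ` A)"
    unfolding fract_subspace_iff using A
    by (force simp: is_ideal_0 is_ideal_add is_ideal_mult simp flip: to_fract_add to_fract_mult)
  have "1 \<in> ?T"
  proof (rule invertible_ideal_one_mem[OF inv])
    show "module.subspace fract_scale ?T"
      using sub unfolding fract_subspace_iff
      by (auto simp: distrib_left mult.left_commute[of "to_fract y"])
    fix a x assume a: "a \<in> I" and x: "x \<in> inverse_ideal I"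
    let ?Z = "{z. x * to_fract z \<in> to_fract ` A}"
    have "ideal_mult I A \<subseteq> ?Z"
    proof (rule ideal_mult_subset)
      show "is_ideal ?Z"
        using sub unfolding fract_subspace_iff
        by (intro is_idealI) (auto simp: distrib_left mult.left_commute[of x])
      fix b c assume b: "b \<in> I" and c: "c \<in> A"
      obtain r where "to_fract b * x = to_fract r" using inverse_idealD[OF x b] by blast
      then have "x * to_fract (b * c) = to_fract (r * c)" by (simp add: mult_ac)
      then show "b * c \<in> ?Z" using is_ideal_mult[OF A c] by blast
    qed
    then show "to_fract a * x \<in> ?T" using y[OF a] by (auto simp: mult_ac)
  qed
  then show ?thesis by auto
qed

lemma invertible_ideal_ratliff_rush:
  assumes I: "is_ideal I" and inv: "invertible_ideal I"
  shows "ratliff_rush I = I"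
proof
  show "ratliff_rush I \<subseteq> I"
  proof
    fix x assume "x \<in> ratliff_rush I"
    then obtain n where "\<And>y. y \<in> ideal_power I n \<Longrightarrow> x * y \<in> ideal_power I (Suc n)"
      by (rule ratliff_rushE) auto
    then show "x \<in> I"
    proof (induction n)
      case 0
      from 0[of 1] show ?case by (simp add: ideal_mult_UNIV[OF I])
    next
      case (Suc n)
      have "x * y \<in> ideal_power I (Suc n)" if "y \<in> ideal_power I n" for y
      proof (rule invertible_ideal_cancel[OF inv is_ideal_ideal_power])
        fix a assume "a \<in> I"
        then have "a * y \<in> ideal_power I (Suc n)" using that by (simp add: ideal_mult_mem)
        from Suc.prems[OF this] show "x * y * a \<in> ideal_mult I (ideal_power I (Suc n))"
          by (simp add: mult_ac)
      qed
      then show ?case by (rule Suc.IH)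
    qed
  qed
qed (rule ratliff_rush_superset[OF I])


section \<open>Roots of polynomials over an integrally closed domain\<close>

lemma integrally_closed_lead_coeff_mult:
  assumes ic: "integrally_closed_domain TYPE('a::idom)"
    and root: "(\<Sum>i\<le>Suc m. to_fract (f i :: 'a) * x ^ i) = 0"
  shows "to_fract (f (Suc m)) * x \<in> range to_fract"
proof -
  let ?c = "f (Suc m)"
  \<comment> \<open>The polynomial \<open>c\<^sup>m f(X / c)\<close> is monic and has the root \<open>c x\<close>.\<close>
  define q where "q = (\<Sum>i\<le>m. monom (f i * ?c ^ (m - i)) i)"
  define p where "p = monom 1 (Suc m) + q"
  have deg: "degree q \<le> m"
    unfolding q_def by (intro degree_sum_le) (auto intro: order_trans[OF degree_monom_le])
  then have "degree p = Suc m"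
    unfolding p_def by (subst degree_add_eq_left) (auto simp: degree_monom_eq)
  moreover have "coeff q (Suc m) = 0" using deg by (intro coeff_eq_0) simp
  ultimately have lead: "lead_coeff p = 1"
    by (simp add: p_def)
  have monom: "fract_poly (monom c i) = monom (to_fract c) i" for c :: 'a and i
    by (simp add: map_poly_monom)
  have fsum: "fract_poly (sum h A) = (\<Sum>i\<in>A. fract_poly (h i))" for h :: "nat \<Rightarrow> 'a poly" and A
    by (induction A rule: infinite_finite_induct) auto
  have tp: "to_fract (c ^ n) = to_fract c ^ n" for c :: 'a and n
    by (induction n) auto
  have "poly (fract_poly p) (to_fract ?c * x) =
      (to_fract ?c * x) ^ Suc m + (\<Sum>i\<le>m. to_fract (f i) * to_fract ?c ^ (m - i) * (to_fract ?c * x) ^ i)"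
    by (simp add: p_def q_def fsum monom poly_sum poly_monom tp del: power_Suc)
  also have "(\<Sum>i\<le>m. to_fract (f i) * to_fract ?c ^ (m - i) * (to_fract ?c * x) ^ i) =
      to_fract ?c ^ m * (\<Sum>i\<le>m. to_fract (f i) * x ^ i)"
    unfolding sum_distrib_left
  proof (rule sum.cong)
    fix i assume "i \<in> {..m}"
    then have "to_fract ?c ^ m = to_fract ?c ^ (m - i) * to_fract ?c ^ i"
      by (simp flip: power_add)
    then show "to_fract (f i) * to_fract ?c ^ (m - i) * (to_fract ?c * x) ^ i =
        to_fract ?c ^ m * (to_fract (f i) * x ^ i)"
      by (simp add: power_mult_distrib mult_ac)
  qed simp
  also have "(to_fract ?c * x) ^ Suc m + to_fract ?c ^ m * (\<Sum>i\<le>m. to_fract (f i) * x ^ i) =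
      to_fract ?c ^ m * (\<Sum>i\<le>Suc m. to_fract (f i) * x ^ i)"
    by (simp add: power_mult_distrib algebra_simps)
  also have "\<dots> = 0" using root by simp
  finally have "integral_over_domain (to_fract ?c * x)"
    using lead unfolding integral_over_domain_def by blast
  then show ?thesis using ic by (auto simp: integrally_closed_domain_def)
qed

text \<open>
  A globalised form of the lemma that \<open>x\<close> or \<open>x\<^sup>-\<^sup>1\<close> lies in a quasi-local integrally closed domain
  if \<open>x\<close> is a root of a polynomial with a unit coefficient. The element \<open>c x\<close>, for \<open>c\<close> the leading
  coefficient, is integral, so the degree can be lowered by absorbing \<open>c x\<close> into the next
  coefficient. The conclusion says that \<open>e\<close> and \<open>e'\<close> in the inverse of \<open>(1, x)\<close> witness its
  invertibility.
\<close>

lemma root_unit_coeff: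
  assumes ic: "integrally_closed_domain TYPE('a::idom)"
    and "(\<Sum>i\<le>d. to_fract (f i :: 'a) * x ^ i) = 0" "k \<le> d" "f k = 1"
  shows "\<exists>e e'. to_fract e * x \<in> range to_fract \<and> to_fract e' * x \<in> range to_fract \<and>
    to_fract e' - to_fract e * x = 1"
  using assms(2-)
proof (induction d arbitrary: f)
  case 0
  then show ?case by simp
next
  case (Suc m)
  obtain y where y: "to_fract (f (Suc m)) * x = to_fract y"
    using integrally_closed_lead_coeff_mult[OF ic Suc.prems(1)] by blast
  define g where "g = f(m := f m + y)"
  have "(\<Sum>i\<le>m. to_fract (g i) * x ^ i) = (\<Sum>i<m. to_fract (f i) * x ^ i) + to_fract (f m + y) * x ^ m"
    by (simp add: g_def flip: lessThan_Suc_atMost)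
  also have "\<dots> = (\<Sum>i\<le>Suc m. to_fract (f i) * x ^ i)"
    using y[symmetric] by (simp add: algebra_simps flip: lessThan_Suc_atMost)
  finally have g: "(\<Sum>i\<le>m. to_fract (g i) * x ^ i) = 0"
    using Suc.prems(1) by simp
  consider "k = Suc m" | "k = m" | "k < m" using Suc.prems(2) by linarith
  then show ?case
  proof cases
    case 1
    then have x: "x = to_fract y" using y Suc.prems(3) by simp
    have "to_fract (1 + y) * x = to_fract ((1 + y) * y)" by (simp only: x to_fract_mult)
    then have "to_fract (1 + y) * x \<in> range to_fract" by blast
    moreover have "to_fract 1 * x \<in> range to_fract" by (simp add: x)
    moreover have "to_fract (1 + y) - to_fract 1 * x = 1" by (simp add: x)
    ultimately show ?thesis by blast
  next
    case 2
    \<comment> \<open>The absorption changes the coefficient \<open>1\<close> into \<open>1 + c x\<close>, now the leading one: this is \<open>e'\<close>.\<close>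
    have gm: "g m = 1 + y" using 2 Suc.prems(3) by (simp add: g_def)
    have "to_fract (g m) * x \<in> range to_fract"
    proof (cases m)
      case 0
      then show ?thesis using g by (auto intro!: range_eqI[of _ _ 0])
    next
      case (Suc l)
      with g have "(\<Sum>i\<le>Suc l. to_fract (g i) * x ^ i) = 0" by simp
      then show ?thesis unfolding Suc by (rule integrally_closed_lead_coeff_mult[OF ic])
    qed
    then show ?thesis
      using y gm by (intro exI[of _ "f (Suc m)"] exI[of _ "g m"]) auto
  next
    case 3
    then show ?thesis using Suc.IH[OF g] Suc.prems(3) by (simp add: g_def)
  qed
qed

lemma ratliff_rush_imp_arithmetical:
  assumes ic: "integrally_closed_domain TYPE('a::idom)"
    and rr: "\<And>I::'a set. is_ideal I \<Longrightarrow> I \<noteq> {0} \<Longrightarrow> fin_gen_ideal I \<Longrightarrow> ratliff_rush I = I"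
  shows "arithmetical TYPE('a)"
  unfolding arithmetical_def
proof (intro allI)
  fix a b :: 'a
  consider "a = 0" | "b = 0" | "a \<noteq> 0" "b \<noteq> 0" by blast
  then show "\<exists>u. b dvd u * a \<and> a dvd (1 - u) * b"
  proof cases
    case 1
    then show ?thesis by (intro exI[of _ 1]) auto
  next
    case 2
    then show ?thesis by (intro exI[of _ 0]) auto
  next
    case 3
    \<comment> \<open>All monomials of degree \<open>4\<close> except \<open>a\<^sup>2 b\<^sup>2\<close>; their products are all the monomials of degree \<open>8\<close>.\<close>
    define G where "G = {a^4, a^3 * b, a * b^3, b^4}"
    define J where "J = ideal_gen G"
    have J: "is_ideal J" by (simp add: J_def is_ideal_ideal_gen)
    have GJ: "G \<subseteq> J" by (simp add: J_def ideal_gen_superset)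
    have "a^2 * b^2 \<in> ratliff_rush J"
    proof (rule ratliff_rushI[of 1])
      fix z assume "z \<in> ideal_power J 1"
      then have "z \<in> J" using J by (simp add: ideal_mult_UNIV)
      have prod: "g * h \<in> ideal_mult J J" if "g \<in> G" "h \<in> G" for g h
        using that GJ by (intro ideal_mult_mem) auto
      have "J \<subseteq> {z. a^2 * b^2 * z \<in> ideal_mult J J}"
        unfolding J_def
      proof (rule ideal_gen_minimal)
        show "is_ideal {z. a^2 * b^2 * z \<in> ideal_mult (ideal_gen G) (ideal_gen G)}"
          using is_ideal_ideal_mult[of "ideal_gen G" "ideal_gen G"]
          by (intro is_idealI)
            (auto simp: distrib_left is_ideal_0 is_ideal_add mult.left_commute[of "a^2 * b^2"] is_ideal_mult)
        have "a^2 * b^2 * a^4 = (a^3 * b) * (a^3 * b)" "a^2 * b^2 * (a^3 * b) = a^4 * (a * b^3)"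
          "a^2 * b^2 * (a * b^3) = (a^3 * b) * b^4" "a^2 * b^2 * b^4 = (a * b^3) * (a * b^3)"
          by (simp_all add: eval_nat_numeral mult_ac)
        then show "G \<subseteq> {z. a^2 * b^2 * z \<in> ideal_mult (ideal_gen G) (ideal_gen G)}"
          using prod[unfolded J_def] by (auto simp: G_def)
      qed
      then have "a^2 * b^2 * z \<in> ideal_mult J J" using \<open>z \<in> J\<close> by blast
      then show "a^2 * b^2 * z \<in> ideal_power J (Suc 1)"
        using J by (simp add: ideal_mult_UNIV)
    qed simp
    moreover have "ratliff_rush J = J"
    proof (rule rr[OF J])
      show "J \<noteq> {0}" using GJ 3 by (auto simp: G_def)
      show "fin_gen_ideal J" unfolding fin_gen_ideal_def J_def by (intro exI[of _ G]) (simp add: G_def)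
    qed
    ultimately have mem: "a^2 * b^2 \<in> J" by simp
    let ?L = "{r * a^4 + s * (a^3 * b) + t * (a * b^3) + u * b^4 | r s t u. True}"
    have "J \<subseteq> ?L"
      unfolding J_def
    proof (rule ideal_gen_minimal)
      show "is_ideal ?L"
      proof (rule is_idealI)
        show "0 \<in> ?L" by (auto intro!: exI[of _ 0])
        show "y + z \<in> ?L" if "y \<in> ?L" "z \<in> ?L" for y z
        proof -
          from that obtain r s t u r' s' t' u'
            where "y = r * a^4 + s * (a^3 * b) + t * (a * b^3) + u * b^4"
              "z = r' * a^4 + s' * (a^3 * b) + t' * (a * b^3) + u' * b^4" by blast
          then have "y + z = (r + r') * a^4 + (s + s') * (a^3 * b) + (t + t') * (a * b^3) + (u + u') * b^4"
            by (simp add: algebra_simps)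
          then show ?thesis by blast
        qed
        show "c * y \<in> ?L" if "y \<in> ?L" for c y
        proof -
          from that obtain r s t u
            where "y = r * a^4 + s * (a^3 * b) + t * (a * b^3) + u * b^4" by blast
          then have "c * y = (c * r) * a^4 + (c * s) * (a^3 * b) + (c * t) * (a * b^3) + (c * u) * b^4"
            by (simp add: algebra_simps)
          then show ?thesis by blast
        qed
      qed
      have "a^4 = 1 * a^4 + 0 * (a^3 * b) + 0 * (a * b^3) + 0 * b^4"
        "a^3 * b = 0 * a^4 + 1 * (a^3 * b) + 0 * (a * b^3) + 0 * b^4"
        "a * b^3 = 0 * a^4 + 0 * (a^3 * b) + 1 * (a * b^3) + 0 * b^4"
        "b^4 = 0 * a^4 + 0 * (a^3 * b) + 0 * (a * b^3) + 1 * b^4"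
        by simp_all
      then show "G \<subseteq> ?L" unfolding G_def by blast
    qed
    then obtain r s t u where eq: "a^2 * b^2 = r * a^4 + s * (a^3 * b) + t * (a * b^3) + u * b^4"
      using mem by blast
    define x where "x = to_fract a / to_fract b"
    have ax: "to_fract a = to_fract b * x" using 3 by (simp add: x_def)
    define f where "f = (\<lambda>i::nat. if i = 0 then - u else if i = 1 then - t else if i = 2 then 1
      else if i = 3 then - s else - r)"
    have "to_fract b ^ 4 * (\<Sum>i\<le>4. to_fract (f i) * x ^ i) =
        to_fract (a^2 * b^2 - (r * a^4 + s * (a^3 * b) + t * (a * b^3) + u * b^4))"
      by (simp add: f_def eval_nat_numeral ax algebra_simps)
    also have "\<dots> = 0" using eq by simp
    finally have "(\<Sum>i\<le>4. to_fract (f i) * x ^ i) = 0" using 3 by simp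
    from root_unit_coeff[OF ic this, of 2] obtain e e' v w where
      v: "to_fract e * x = to_fract v" and w: "to_fract e' * x = to_fract w" and
      1: "to_fract e' - to_fract e * x = 1" by (auto simp: f_def)
    have "to_fract (e' * a) = to_fract (b * w)" using w by (simp add: ax mult_ac)
    moreover have "to_fract ((1 - e') * b) = to_fract (a * - e)"
    proof -
      have "to_fract ((1 - e') * b) = - to_fract e * x * to_fract b"
        using 1 by (simp add: algebra_simps)
      then show ?thesis by (simp add: ax mult_ac)
    qed
    ultimately show ?thesis
      unfolding to_fract_eq_iff by (metis dvd_triv_left)
  qed
qed


section \<open>Prime ideals and locally idempotent ideals\<close>

lemma prime_ideal_is_ideal: "prime_ideal P \<Longrightarrow> is_ideal P"
  and prime_ideal_mult_notin: "prime_ideal P \<Longrightarrow> a \<notin> P \<Longrightarrow> b \<notin> P \<Longrightarrow> a * b \<notin> P"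
  by (auto simp: prime_ideal_def)

lemma prime_ideal_one_notin: "prime_ideal P \<Longrightarrow> 1 \<notin> P"
  using is_ideal_mult_right[of P 1] by (auto simp: prime_ideal_def)

lemma exists_prime_ideal_superset:
  assumes L: "is_ideal L" "1 \<notin> L"
  shows "\<exists>M. prime_ideal M \<and> L \<subseteq> M"
proof -
  let ?A = "{I. is_ideal I \<and> L \<subseteq> I \<and> 1 \<notin> I}"
  have "\<exists>M\<in>?A. \<forall>X\<in>?A. M \<subseteq> X \<longrightarrow> X = M"
  proof (rule subset_Zorn_nonempty)
    show "?A \<noteq> {}" using L by blast
    fix C assume C: "C \<noteq> {}" "subset.chain ?A C"
    then have CA: "C \<subseteq> ?A" and lin: "\<And>X Y. X \<in> C \<Longrightarrow> Y \<in> C \<Longrightarrow> X \<subseteq> Y \<or> Y \<subseteq> X"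
      by (auto simp: subset_chain_def)
    have "is_ideal (\<Union>C)"
    proof (rule is_idealI)
      show "0 \<in> \<Union>C" using C(1) CA is_ideal_0 by blast
      show "x + y \<in> \<Union>C" if xy: "x \<in> \<Union>C" "y \<in> \<Union>C" for x y
      proof -
        obtain X Y where "X \<in> C" "Y \<in> C" "x \<in> X" "y \<in> Y" using xy by blast
        then obtain Z where "Z \<in> C" "x \<in> Z" "y \<in> Z" using lin by blast
        then show ?thesis using CA is_ideal_add[of Z x y] by blast
      qed
      show "r * x \<in> \<Union>C" if "x \<in> \<Union>C" for r x
        using that CA is_ideal_mult by blast
    qed
    then show "\<Union>C \<in> ?A" using C(1) CA by blast
  qed
  then obtain M where "M \<in> ?A" and max': "\<forall>X\<in>?A. M \<subseteq> X \<longrightarrow> X = M" ..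
  then have M: "is_ideal M" "L \<subseteq> M" "1 \<notin> M" by auto
  have max: "X = M" if "is_ideal X" "M \<subseteq> X" "1 \<notin> X" for X
    using max'[rule_format, of X] that M(2) by auto
  \<comment> \<open>If \<open>a \<notin> M\<close>, then maximality puts \<open>1\<close> into \<open>M + (a)\<close>.\<close>
  have comax: "\<exists>m\<in>M. \<exists>r. 1 = m + r * a" if "a \<notin> M" for a
  proof (rule ccontr)
    assume no: "\<not> ?thesis"
    let ?X = "{m + r * a | m r. m \<in> M}"
    have "is_ideal ?X"
    proof (rule is_idealI)
      have "0 = 0 + 0 * a" "0 \<in> M" using is_ideal_0[OF M(1)] by auto
      then show "0 \<in> ?X" by blast
      show "y + z \<in> ?X" if "y \<in> ?X" "z \<in> ?X" for y z
      proof -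
        from that obtain m r m' r' where "y = m + r * a" "z = m' + r' * a" "m \<in> M" "m' \<in> M" by blast
        then have "y + z = (m + m') + (r + r') * a" "m + m' \<in> M"
          using M(1) by (auto simp: algebra_simps is_ideal_add)
        then show ?thesis by blast
      qed
      show "c * y \<in> ?X" if "y \<in> ?X" for c y
      proof -
        from that obtain m r where "y = m + r * a" "m \<in> M" by blast
        then have "c * y = c * m + (c * r) * a" "c * m \<in> M"
          using M(1) by (auto simp: algebra_simps is_ideal_mult)
        then show ?thesis by blast
      qed
    qed
    moreover have "M \<subseteq> ?X"
    proof
      fix m assume "m \<in> M"
      then have "m = m + 0 * a" "m \<in> M" by auto
      then show "m \<in> ?X" by blast
    qed
    moreover have "1 \<notin> ?X" using no by blast
    ultimately have "?X = M" by (rule max)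
    moreover have "a \<in> ?X"
    proof -
      have "a = 0 + 1 * a" "0 \<in> M" using is_ideal_0[OF M(1)] by auto
      then show ?thesis by blast
    qed
    ultimately show False using that by blast
  qed
  have "prime_ideal M"
    unfolding prime_ideal_def
  proof (intro conjI allI impI)
    fix a b assume ab: "a * b \<in> M"
    show "a \<in> M \<or> b \<in> M"
    proof (rule disjCI)
      assume "b \<notin> M"
      then obtain m r where m: "m \<in> M" "1 = m + r * b" using comax by blast
      have "a = a * (m + r * b)" using m(2) by simp
      also have "\<dots> = a * m + r * (a * b)" by (simp add: algebra_simps)
      finally show "a \<in> M" using M(1) m(1) ab by (metis is_ideal_add is_ideal_mult)
    qed
  qed (use M in auto)
  with M(2) show ?thesis by blast
qed

text \<open>The contraction to \<open>R\<close> of the extension of \<open>A\<close> to the localisation at \<open>M\<close>.\<close>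

definition local_closure :: "'a::comm_ring_1 set \<Rightarrow> 'a set \<Rightarrow> 'a set"
  where "local_closure M A = {r. \<exists>s. s \<notin> M \<and> s * r \<in> A}"

lemma local_closureI: "s \<notin> M \<Longrightarrow> s * r \<in> A \<Longrightarrow> r \<in> local_closure M A"
  by (auto simp: local_closure_def)

lemma local_closureE:
  assumes "r \<in> local_closure M A"
  obtains s where "s \<notin> M" "s * r \<in> A"
  using assms by (auto simp: local_closure_def)

lemma is_ideal_local_closure:
  assumes M: "prime_ideal M" and A: "is_ideal A"
  shows "is_ideal (local_closure M A)"
proof (rule is_idealI)
  show "0 \<in> local_closure M A"
    using prime_ideal_one_notin[OF M] A by (intro local_closureI[of 1]) (auto simp: is_ideal_0)
  show "x + y \<in> local_closure M A" if "x \<in> local_closure M A" "y \<in> local_closure M A" for x y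
  proof -
    from that obtain s t where "s \<notin> M" "s * x \<in> A" "t \<notin> M" "t * y \<in> A"
      by (auto elim!: local_closureE)
    moreover have "s * t * (x + y) = t * (s * x) + s * (t * y)" by (simp add: algebra_simps)
    ultimately show ?thesis
      using A M by (intro local_closureI[of "s * t"]) (auto simp: prime_ideal_mult_notin is_ideal_add is_ideal_mult)
  qed
  show "r * x \<in> local_closure M A" if "x \<in> local_closure M A" for r x
    using that A by (auto elim!: local_closureE intro!: local_closureI simp: mult.left_commute[of _ r] is_ideal_mult)
qed

lemma local_closure_superset: "prime_ideal M \<Longrightarrow> A \<subseteq> local_closure M A"
  by (auto intro!: local_closureI[of 1] simp: prime_ideal_one_notin)

lemma local_closure_absorb:
  assumes "prime_ideal M" "s \<notin> M" "s * r \<in> local_closure M A"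
  shows "r \<in> local_closure M A"
  using assms by (auto elim!: local_closureE intro!: local_closureI[of "_ * s"]
      simp: prime_ideal_mult_notin mult.assoc)

text \<open>
  In an arithmetical domain, the square of a prime ideal is primary. Hence the inclusion
  \<open>P \<subseteq> P\<^sup>2\<close> for a prime ideal \<open>P\<close> can be tested locally at \<open>P\<close>.
\<close>

lemma prime_square_primary:
  assumes ar: "arithmetical TYPE('a::idom)" and P: "prime_ideal (P::'a set)"
    and s: "s \<notin> P" and sr: "s * r \<in> ideal_mult P P"
  shows "r \<in> ideal_mult P P"
proof -
  have I: "is_ideal P" using P by (rule prime_ideal_is_ideal)
  have I2: "is_ideal (ideal_mult P P)" by (rule is_ideal_ideal_mult)
  have s0: "s \<noteq> 0" using s is_ideal_0[OF I] by auto
  \<comment> \<open>Locally at \<open>P\<close>, we have \<open>P = s P\<close> and hence \<open>P\<^sup>2 = s P\<^sup>2\<close>.\<close>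
  let ?T = "{z. \<exists>u. 1 - u \<in> P \<and> (\<exists>y\<in>ideal_mult P P. u * z = s * y)}"
  have "ideal_mult P P \<subseteq> ?T"
  proof (rule ideal_mult_subset)
    show "is_ideal ?T"
    proof (rule is_idealI)
      show "0 \<in> ?T" using is_ideal_0[OF I] is_ideal_0[OF I2] by (auto intro!: exI[of _ 1] bexI[of _ 0])
      show "z + z' \<in> ?T" if zz: "z \<in> ?T" "z' \<in> ?T" for z z'
      proof -
        obtain u y u' y' where *: "1 - u \<in> P" "y \<in> ideal_mult P P" "u * z = s * y"
          "1 - u' \<in> P" "y' \<in> ideal_mult P P" "u' * z' = s * y'" using zz by blast
        have "1 - u * u' = (1 - u) + u * (1 - u')" by (simp add: algebra_simps)
        also have "\<dots> \<in> P" using * I by (intro is_ideal_add is_ideal_mult)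
        finally have "1 - u * u' \<in> P" .
        moreover have "u * u' * (z + z') = u' * (u * z) + u * (u' * z')" by (simp add: algebra_simps)
        then have "u * u' * (z + z') = s * (u' * y + u * y')"
          using * by (simp add: algebra_simps)
        moreover have "u' * y + u * y' \<in> ideal_mult P P" using * I2 by (simp add: is_ideal_add is_ideal_mult)
        ultimately show ?thesis by blast
      qed
      show "c * z \<in> ?T" if z: "z \<in> ?T" for c z
      proof -
        obtain u y where *: "1 - u \<in> P" "y \<in> ideal_mult P P" "u * z = s * y" using z by blast
        then have "u * (c * z) = s * (c * y)" by (simp add: mult.left_commute)
        then show ?thesis using * is_ideal_mult[OF I2] by blast
      qed
    qed
    fix p q assume p: "p \<in> P" and q: "q \<in> P"
    obtain u where u: "s dvd u * p" "p dvd (1 - u) * s" using arithmeticalE[OF ar] by blast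
    obtain w where w: "u * p = s * w" using u(1) by (auto elim: dvdE)
    have "(1 - u) * s \<in> P" using u(2) p I by (auto elim!: dvdE simp: is_ideal_mult_right)
    then have "1 - u \<in> P" using P s by (auto simp: prime_ideal_def)
    moreover have "s * w \<in> P" using p I unfolding w[symmetric] by (rule is_ideal_mult[rotated])
    then have "w \<in> P" using P s by (auto simp: prime_ideal_def)
    then have "w * q \<in> ideal_mult P P" using q by (rule ideal_mult_mem)
    moreover have "u * (p * q) = s * (w * q)" using w by (simp flip: mult.assoc)
    ultimately show "p * q \<in> ?T" by blast
  qed
  then obtain u y where u: "1 - u \<in> P" and y: "y \<in> ideal_mult P P" "u * (s * r) = s * y" using sr by blast
  then have "u * r = y" using s0 by (simp add: mult.left_commute[of u])
  moreover have "s * r \<in> P"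
    using sr ideal_mult_subset[OF I, of P P] is_ideal_mult[OF I] by blast
  then have "r \<in> P" using P s by (auto simp: prime_ideal_def)
  then have "(1 - u) * r \<in> ideal_mult P P" using u by (rule ideal_mult_mem[rotated])
  moreover have "r = u * r + (1 - u) * r" by (simp add: algebra_simps)
  ultimately show ?thesis using y I2 by (metis is_ideal_add)
qed

text \<open>
  A proper idempotent ideal of a valuation domain is prime. Here the valuation domain is the
  localisation at \<open>M\<close>, and the prime ideal is contracted to \<open>R\<close>, where it is still idempotent.
\<close>

lemma locally_idempotent_prime:
  assumes ar: "arithmetical TYPE('a::idom)" and M: "prime_ideal (M::'a set)"
    and A: "is_ideal A" and AM: "A \<subseteq> M" and idem: "A \<subseteq> local_closure M (ideal_mult A A)"
  defines "P \<equiv> local_closure M A"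
  shows "prime_ideal P" "P = ideal_power P 2"
proof -
  have P: "is_ideal P" unfolding P_def by (rule is_ideal_local_closure[OF M A])
  have AP: "A \<subseteq> P" unfolding P_def by (rule local_closure_superset[OF M])
  have PM: "P \<subseteq> M" using M AM by (auto simp: P_def prime_ideal_def elim!: local_closureE)
  have sq: "\<exists>s. s \<notin> M \<and> s * r \<in> ideal_mult A A" if r: "r \<in> P" for r
  proof -
    obtain s where s: "s \<notin> M" "s * r \<in> A" using r unfolding P_def by (rule local_closureE)
    then obtain t where "t \<notin> M" "t * (s * r) \<in> ideal_mult A A"
      using idem by (blast elim: local_closureE)
    then show ?thesis using prime_ideal_mult_notin[OF M _ s(1)] by (metis mult.assoc)
  qed
  show prime: "prime_ideal P"
    unfolding prime_ideal_def
  proof (intro conjI allI impI)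
    show "P \<noteq> UNIV" using PM prime_ideal_one_notin[OF M] by blast
    fix a b assume ab: "a * b \<in> P"
    show "a \<in> P \<or> b \<in> P"
    proof (subst disj_commute, rule disjCI)
      assume a: "a \<notin> P"
      then have a0: "a \<noteq> 0" using is_ideal_0[OF P] by auto
      \<comment> \<open>Locally at \<open>M\<close>, we have \<open>A \<subseteq> (a)\<close> and hence \<open>A\<^sup>2 \<subseteq> a A\<close>.\<close>
      let ?T = "{z. \<exists>v. v \<notin> M \<and> (\<exists>q\<in>P. v * z = a * q)}"
      have "ideal_mult A A \<subseteq> ?T"
      proof (rule ideal_mult_subset)
        show "is_ideal ?T"
        proof (rule is_idealI)
          show "0 \<in> ?T"
            using is_ideal_0[OF P] prime_ideal_one_notin[OF M] by (auto intro!: exI[of _ 1] bexI[of _ 0])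
          show "z + z' \<in> ?T" if zz: "z \<in> ?T" "z' \<in> ?T" for z z'
          proof -
            obtain v q v' q' where *: "v \<notin> M" "q \<in> P" "v * z = a * q"
              "v' \<notin> M" "q' \<in> P" "v' * z' = a * q'" using zz by blast
            have "v * v' * (z + z') = v' * (v * z) + v * (v' * z')" by (simp add: algebra_simps)
            then have "v * v' * (z + z') = a * (v' * q + v * q')"
              using * by (simp add: algebra_simps)
            moreover have "v' * q + v * q' \<in> P" using * P by (simp add: is_ideal_add is_ideal_mult)
            ultimately show ?thesis using prime_ideal_mult_notin[OF M *(1,4)] by blast
          qed
          show "c * z \<in> ?T" if z: "z \<in> ?T" for c z
          proof -
            obtain v q where *: "v \<notin> M" "q \<in> P" "v * z = a * q" using z by blast
            then have "v * (c * z) = a * (c * q)" by (simp add: mult.left_commute)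
            then show ?thesis using * is_ideal_mult[OF P] by blast
          qed
        qed
        fix p q assume p: "p \<in> A" and q: "q \<in> A"
        obtain u where u: "p dvd u * a" "a dvd (1 - u) * p" using arithmeticalE[OF ar] by blast
        have "u \<in> M"
        proof (rule ccontr)
          assume "u \<notin> M"
          moreover have "u * a \<in> A" using u(1) p A by (auto elim!: dvdE simp: is_ideal_mult_right)
          ultimately show False using a by (auto simp: P_def intro: local_closureI)
        qed
        then have "1 - u \<notin> M"
          using is_ideal_add[OF prime_ideal_is_ideal[OF M], of "1 - u" u] prime_ideal_one_notin[OF M] by auto
        moreover obtain w where w: "(1 - u) * p = a * w" using u(2) by (auto elim: dvdE)
        then have "(1 - u) * (p * q) = a * (w * q)" by (simp flip: mult.assoc)
        moreover have "w * q \<in> P" using q AP is_ideal_mult[OF P] by blast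
        ultimately show "p * q \<in> ?T" by blast
      qed
      moreover obtain s where s: "s \<notin> M" "s * (a * b) \<in> ideal_mult A A" using sq[OF ab] by blast
      ultimately obtain v q where v: "v \<notin> M" "q \<in> P" "v * (s * (a * b)) = a * q" by blast
      have "a * (v * s * b) = a * q" using v(3) by (simp add: mult_ac)
      then have "v * s * b = q" using a0 by simp
      then show "b \<in> P"
        using v(2) local_closure_absorb[OF M prime_ideal_mult_notin[OF M v(1) s(1)]]
        by (simp add: P_def)
    qed
  qed (rule P)
  have "P = ideal_mult P P"
  proof
    show "ideal_mult P P \<subseteq> P" by (rule ideal_mult_subset[OF P]) (rule is_ideal_mult[OF P])
    show "P \<subseteq> ideal_mult P P"
    proof
      fix r assume "r \<in> P"
      then obtain s where "s \<notin> M" "s * r \<in> ideal_mult A A" using sq by blast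
      then show "r \<in> ideal_mult P P"
        using PM ideal_mult_mono[OF AP AP] by - (rule prime_square_primary[OF ar prime, of s r], blast+)
    qed
  qed
  also have "\<dots> = ideal_power P 2" by (rule ideal_power_2[OF P, symmetric])
  finally show "P = ideal_power P 2" .
qed


section \<open>Ratliff-Rush closure in strongly discrete Pruefer domains\<close>

lemma power_mult_mem_ideal_power:
  assumes "\<And>y. y \<in> L \<Longrightarrow> x * y \<in> I" "y \<in> ideal_power L n"
  shows "x ^ n * y \<in> ideal_power I n"
  using assms(2)
proof (induction n arbitrary: y)
  case (Suc n)
  have "ideal_mult L (ideal_power L n) \<subseteq> {y. x ^ Suc n * y \<in> ideal_power I (Suc n)}" (is "_ \<subseteq> ?T")
  proof (rule ideal_mult_subset)
    show "is_ideal ?T"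
      using is_ideal_ideal_power[of I "Suc n"]
      by (intro is_idealI)
        (simp_all only: mem_Collect_eq distrib_left mult_zero_right is_ideal_0 is_ideal_add
          mult.left_commute[of "x ^ Suc n"] is_ideal_mult)
    fix a b assume ab: "a \<in> L" "b \<in> ideal_power L n"
    have "(x * a) * (x ^ n * b) \<in> ideal_power I (Suc n)"
      using assms(1)[OF ab(1)] Suc.IH[OF ab(2)] by (simp add: ideal_mult_mem)
    then show "a * b \<in> ?T" by (simp add: mult_ac)
  qed
  then show ?case using Suc.prems by auto
qed simp

text \<open>If \<open>I \<subseteq> x L\<close> locally at \<open>M\<close>, then \<open>I\<^sup>n \<subseteq> x\<^sup>n L\<^sup>n\<close> locally at \<open>M\<close>.\<close>

lemma ideal_power_local_factor:
  assumes M: "prime_ideal M" and "\<And>i. i \<in> I \<Longrightarrow> \<exists>s. s \<notin> M \<and> (\<exists>y\<in>L. s * i = x * y)"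
    and "z \<in> ideal_power I n"
  shows "\<exists>s. s \<notin> M \<and> (\<exists>y\<in>ideal_power L n. s * z = x ^ n * y)"
  using assms(3)
proof (induction n arbitrary: z)
  case 0
  then show ?case using prime_ideal_one_notin[OF M] by (intro exI[of _ 1]) auto
next
  case (Suc n)
  let ?T = "{z. \<exists>s. s \<notin> M \<and> (\<exists>y\<in>ideal_power L (Suc n). s * z = x ^ Suc n * y)}"
  have L: "is_ideal (ideal_power L (Suc n))" by (rule is_ideal_ideal_power)
  have "ideal_mult I (ideal_power I n) \<subseteq> ?T"
  proof (rule ideal_mult_subset)
    show "is_ideal ?T"
    proof (rule is_idealI)
      show "0 \<in> ?T" using is_ideal_0[OF L] prime_ideal_one_notin[OF M]
        by (auto intro!: exI[of _ 1] bexI[of _ 0])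
      show "z + z' \<in> ?T" if zz: "z \<in> ?T" "z' \<in> ?T" for z z'
      proof -
        obtain v q v' q' where *: "v \<notin> M" "q \<in> ideal_power L (Suc n)" "v * z = x ^ Suc n * q"
          "v' \<notin> M" "q' \<in> ideal_power L (Suc n)" "v' * z' = x ^ Suc n * q'" using zz by blast
        have "v * v' * (z + z') = v' * (v * z) + v * (v' * z')" by (simp add: algebra_simps)
        then have "v * v' * (z + z') = x ^ Suc n * (v' * q + v * q')"
          unfolding *(3,6) by (simp add: algebra_simps)
        moreover have "v' * q + v * q' \<in> ideal_power L (Suc n)"
          using *(2,5) L by (intro is_ideal_add is_ideal_mult)
        ultimately show ?thesis using prime_ideal_mult_notin[OF M *(1,4)] by blast
      qed
      show "c * z \<in> ?T" if z: "z \<in> ?T" for c z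
      proof -
        obtain v q where *: "v \<notin> M" "q \<in> ideal_power L (Suc n)" "v * z = x ^ Suc n * q" using z by blast
        then have "v * (c * z) = x ^ Suc n * (c * q)" by (simp only: mult.left_commute)
        then show ?thesis using * is_ideal_mult[OF L] by blast
      qed
    qed
    fix a b assume "a \<in> I" "b \<in> ideal_power I n"
    then obtain s y t w where *: "s \<notin> M" "y \<in> L" "s * a = x * y"
      "t \<notin> M" "w \<in> ideal_power L n" "t * b = x ^ n * w" using assms(2) Suc.IH by meson
    have "s * t * (a * b) = (s * a) * (t * b)" by (simp add: mult_ac)
    also have "\<dots> = x ^ Suc n * (y * w)" unfolding *(3,6) by (simp add: mult_ac)
    finally show "a * b \<in> ?T"
      using prime_ideal_mult_notin[OF M *(1,4)] ideal_mult_mem[OF *(2,5)] by auto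
  qed
  then show ?case using Suc.prems by auto
qed

lemma ideal_power_colon_iterate:
  assumes "\<And>y. y \<in> ideal_power I n \<Longrightarrow> x * y \<in> ideal_power I (Suc n)" "y \<in> ideal_power I n"
  shows "x ^ k * y \<in> ideal_power I (k + n)"
proof (induction k)
  case (Suc k)
  have "ideal_power I (k + n) \<subseteq> {z. x * z \<in> ideal_power I (Suc (k + n))}" for k
  proof (induction k)
    case (Suc k)
    show ?case
      unfolding add_Suc ideal_power.simps(2)[of I "k + n"]
    proof (rule ideal_mult_subset)
      show "is_ideal {z. x * z \<in> ideal_power I (Suc (Suc (k + n)))}"
        using is_ideal_ideal_power[of I "Suc (Suc (k + n))"]
        by (intro is_idealI)
          (simp_all only: mem_Collect_eq distrib_left mult_zero_right is_ideal_0 is_ideal_add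
            mult.left_commute[of x] is_ideal_mult)
      fix a b assume ab: "a \<in> I" "b \<in> ideal_power I (k + n)"
      then have "x * b \<in> ideal_power I (Suc (k + n))" using Suc.IH by blast
      then have "a * (x * b) \<in> ideal_power I (Suc (Suc (k + n)))"
        unfolding ideal_power.simps(2)[of I "Suc (k + n)"] by (rule ideal_mult_mem[OF ab(1)])
      then show "a * b \<in> {z. x * z \<in> ideal_power I (Suc (Suc (k + n)))}"
        by (simp only: mem_Collect_eq mult.left_commute)
    qed
  qed (use assms(1) in auto)
  then have "x * (x ^ k * y) \<in> ideal_power I (Suc (k + n))" using Suc.IH by blast
  then show ?case by (simp add: mult.assoc)
qed (use assms(2) in simp)

lemma strongly_discrete_ratliff_rush:
  assumes sd: "strongly_discrete_prufer_domain TYPE('a::idom)"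
    and I: "is_ideal I" "I \<noteq> {0::'a}"
  shows "ratliff_rush I = I"
proof
  have ar: "arithmetical TYPE('a)"
    using sd by (simp add: strongly_discrete_prufer_domain_def prufer_domain_iff_arithmetical)
  show "ratliff_rush I \<subseteq> I"
  proof (rule subsetI, rule ccontr)
    fix x assume "x \<in> ratliff_rush I" and xI: "x \<notin> I"
    then obtain n where n: "n \<ge> 1" and colon: "\<And>y. y \<in> ideal_power I n \<Longrightarrow> x * y \<in> ideal_power I (Suc n)"
      by (auto elim: ratliff_rushE)
    have x0: "x \<noteq> 0" using xI is_ideal_0[OF I(1)] by auto
    define L where "L = {l. x * l \<in> I}"
    have L: "is_ideal L"
      unfolding L_def using I(1)
      by (intro is_idealI) (auto simp: distrib_left is_ideal_0 is_ideal_add mult.left_commute[of x] is_ideal_mult)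
    have "1 \<notin> L" using xI by (simp add: L_def)
    then obtain M where M: "prime_ideal M" "L \<subseteq> M"
      using exists_prime_ideal_superset[OF L] by blast
    have factor: "\<exists>s. s \<notin> M \<and> (\<exists>y\<in>L. s * i = x * y)" if i: "i \<in> I" for i
    proof -
      obtain u where u: "i dvd u * x" "x dvd (1 - u) * i" using arithmeticalE[OF ar] by blast
      have "u * x \<in> I" using u(1) i I(1) by (auto elim!: dvdE simp: is_ideal_mult_right)
      then have "u \<in> M" using M(2) by (auto simp: L_def mult.commute)
      then have "1 - u \<notin> M"
        using is_ideal_add[OF prime_ideal_is_ideal[OF M(1)], of "1 - u" u]
          prime_ideal_one_notin[OF M(1)] by auto
      moreover obtain w where w: "(1 - u) * i = x * w" using u(2) by (auto elim: dvdE)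
      have "(1 - u) * i \<in> I" using I(1) i by (rule is_ideal_mult)
      then have "w \<in> L" using w by (simp add: L_def)
      ultimately show ?thesis using w by blast
    qed
    let ?A = "ideal_power L n"
    have A: "is_ideal ?A" by (rule is_ideal_ideal_power)
    have AM: "?A \<subseteq> M" using ideal_power_subset[OF L n] M(2) by blast
    have "?A \<subseteq> local_closure M (ideal_mult ?A ?A)"
    proof
      fix y assume "y \<in> ?A"
      then have "x ^ n * y \<in> ideal_power I n"
        by (rule power_mult_mem_ideal_power[rotated]) (simp add: L_def)
      from ideal_power_colon_iterate[OF colon this, of n]
      have "x ^ (n + n) * y \<in> ideal_power I (n + n)" by (simp add: power_add mult.assoc)
      from ideal_power_local_factor[OF M(1) factor this]
      obtain s w where s: "s \<notin> M" "w \<in> ideal_power L (n + n)"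
        "s * (x ^ (n + n) * y) = x ^ (n + n) * w" by blast
      have "x ^ (n + n) * (s * y) = x ^ (n + n) * w" using s(3) by (simp only: mult.left_commute)
      then have "s * y = w" using x0 by simp
      then show "y \<in> local_closure M (ideal_mult ?A ?A)"
        using s(1,2) ideal_power_add_subset[of L n n] by (intro local_closureI[of s]) auto
    qed
    note P = locally_idempotent_prime[OF ar M(1) A AM this]
    obtain i where i: "i \<in> I" "i \<noteq> 0" using I is_ideal_0[OF I(1)] by blast
    then have "i \<in> L" using I(1) by (simp add: L_def is_ideal_mult)
    then have "i ^ n \<in> local_closure M ?A"
      using power_mem_ideal_power local_closure_superset[OF M(1)] by blast
    moreover have "i ^ n \<noteq> 0" using i(2) by simp
    ultimately have nz: "local_closure M ?A \<noteq> {0}" by blast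
    have "Q \<noteq> ideal_power Q 2" if "prime_ideal Q" "Q \<noteq> {0}" for Q :: "'a set"
      using sd that unfolding strongly_discrete_prufer_domain_def by blast
    from this[OF P(1) nz] P(2) show False by contradiction
  qed
qed (rule ratliff_rush_superset[OF I(1)])

lemma idempotent_ideal_ratliff_rush:
  assumes P: "is_ideal P" and idem: "P = ideal_power P 2"
  shows "1 \<in> ratliff_rush P"
proof (rule ratliff_rushI[of 1])
  fix y assume "y \<in> ideal_power P 1"
  then have "y \<in> P" by (simp add: ideal_mult_UNIV[OF P])
  then show "1 * y \<in> ideal_power P (Suc 1)" by (subst (asm) idem) (simp add: numeral_2_eq_2)
qed simp

theorem theorem2p6:
  assumes "integrally_closed_domain TYPE('a::idom)"
  shows "((\<forall>I::'a set. is_ideal I \<and> I \<noteq> {0} \<and> fin_gen_ideal I \<longrightarrow> ratliff_rush I = I)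
            \<longleftrightarrow> prufer_domain TYPE('a))
       \<and> ((\<forall>I::'a set. is_ideal I \<and> I \<noteq> {0} \<longrightarrow> ratliff_rush I = I)
            \<longleftrightarrow> strongly_discrete_prufer_domain TYPE('a))"
proof (intro conjI iffI)
  assume "\<forall>I::'a set. is_ideal I \<and> I \<noteq> {0} \<and> fin_gen_ideal I \<longrightarrow> ratliff_rush I = I"
  then show "prufer_domain TYPE('a)"
    using ratliff_rush_imp_arithmetical[OF assms] by (simp add: prufer_domain_iff_arithmetical)
next
  assume "prufer_domain TYPE('a)"
  then show "\<forall>I::'a set. is_ideal I \<and> I \<noteq> {0} \<and> fin_gen_ideal I \<longrightarrow> ratliff_rush I = I"
    by (auto simp: prufer_domain_def invertible_ideal_ratliff_rush)
next
  assume rr: "\<forall>I::'a set. is_ideal I \<and> I \<noteq> {0} \<longrightarrow> ratliff_rush I = I"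
  then have "prufer_domain TYPE('a)"
    using ratliff_rush_imp_arithmetical[OF assms] by (simp add: prufer_domain_iff_arithmetical)
  moreover have "P \<noteq> ideal_power P 2" if P: "prime_ideal P" "P \<noteq> {0}" for P :: "'a set"
    using idempotent_ideal_ratliff_rush[of P] prime_ideal_is_ideal[OF P(1)]
      prime_ideal_one_notin[OF P(1)] rr P(2) by metis
  ultimately show "strongly_discrete_prufer_domain TYPE('a)"
    by (auto simp: strongly_discrete_prufer_domain_def)
next
  assume "strongly_discrete_prufer_domain TYPE('a)"
  then show "\<forall>I::'a set. is_ideal I \<and> I \<noteq> {0} \<longrightarrow> ratliff_rush I = I"
    by (auto simp: strongly_discrete_ratliff_rush)
qed

end
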